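(* Let $0<a<D$, $D_{\max}=D+a$, and assume $$D\alpha\,\frac{\alpha_2}{\alpha_1+\alpha_2+\alpha D_{\max}}+d>g.$$ Then for almost every $\omega\in\Omega$ and every nonnegative global solution $(s(t),m_1(t),m_2(t))$, $t\ge0$, of the random chemostat system $$s'(t)=(D+\psi(\xi^*(\theta_t\omega)))(s_{\mathrm{in}}-\alpha s(t))-c\mu(s(t))(m_1(t)+m_2(t))+rd\,m_1(t),$$ $$m_1'(t)=m_1(t)\big(-d-\alpha(D+\psi(\xi^*(\theta_t\omega)))+g\mu(s(t))-r_1m_1(t)-r_2m_2(t)-\alpha_1\big)+\alpha_2m_2(t),$$ $$m_2'(t)=m_2(t)\big(-d+g\mu(s(t))-r_1m_1(t)-r_2m_2(t)-\alpha_2\big)+\alpha_1m_1(t),$$ the total microbial concentration satisfies $m_1(t)+m_2(t)\to0$ as $t\to+\infty$ (the species goes extinct).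
   Context: Let $\Omega$ be the set of continuous functions $\omega:\mathbb{R}\to\mathbb{R}$ with $\omega(0)=0$, with Borel $\sigma$-algebra and Wiener measure $\mathbb{P}$, and $\theta_t\omega(\cdot)=\omega(\cdot+t)-\omega(t)$ the Wiener shift. The Ornstein–Uhlenbeck process is $\xi^*(\theta_t\omega)=-\int_{-\infty}^0 e^{s}\,\theta_t\omega(s)\,ds$. For a constant $a>0$, $\psi(\xi)=\frac{2a}{\pi}\arctan(\xi)$. Parameters: $D>0$, $s_{\mathrm{in}}>0$, $\alpha>0$, $c>0$, $g\in(0,c]$, $r\in(0,1)$, $d>0$, $\alpha_1,\alpha_2\ge0$, $r_1,r_2\ge0$. The consumption function $\mu:[0,+\infty)\to[0,+\infty)$ is continuous, $\mu(0)=0$, $\mu(x)>0$ for $x>0$, and $\mu(x)\le1$ for all $x\ge0$. *)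

theory Defs
  imports "HOL-Probability.Probability"
begin

definition Omega :: "(real \<Rightarrow> real) set" where
  "Omega = {\<omega>. continuous_on UNIV \<omega> \<and> \<omega> 0 = 0}"

text \<open>Borel sigma-algebra on Omega (compact-open topology), which coincides with the
  sigma-algebra generated by the evaluation maps, i.e. the trace of the product
  sigma-algebra.\<close>
definition Omega_measurable_space :: "(real \<Rightarrow> real) measure" where
  "Omega_measurable_space = restrict_space (Pi\<^sub>M UNIV (\<lambda>_. borel)) Omega"

definition wiener_measure :: "(real \<Rightarrow> real) measure \<Rightarrow> bool" where
  "wiener_measure P \<longleftrightarrow>
     prob_space P \<and> sets P = sets Omega_measurable_space \<and> space P = Omega \<and>
     (\<forall>t u. t < u \<longrightarrow>
        distributed P lborel (\<lambda>\<omega>. \<omega> u - \<omega> t)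
          (\<lambda>x. ennreal (normal_density 0 (sqrt (u - t)) x))) \<and>
     (\<forall>ts :: real list. sorted ts \<and> distinct ts \<longrightarrow>
        prob_space.indep_vars P (\<lambda>_. borel)
          (\<lambda>i \<omega>. \<omega> (ts ! Suc i) - \<omega> (ts ! i)) {..<length ts - 1})"

definition wiener_shift :: "real \<Rightarrow> (real \<Rightarrow> real) \<Rightarrow> (real \<Rightarrow> real)" where
  "wiener_shift t \<omega> = (\<lambda>s. \<omega> (s + t) - \<omega> t)"

definition OU :: "(real \<Rightarrow> real) \<Rightarrow> real" where
  "OU \<omega> = - (LINT s:{..0}|lborel. exp s * \<omega> s)"

definition psi :: "real \<Rightarrow> real \<Rightarrow> real" where
  "psi a \<xi> = 2 * a / pi * arctan \<xi>"

definition Drand :: "real \<Rightarrow> real \<Rightarrow> (real \<Rightarrow> real) \<Rightarrow> real \<Rightarrow> real" where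
  "Drand D a \<omega> t = D + psi a (OU (wiener_shift t \<omega>))"

definition chemostat_solution ::
  "real \<Rightarrow> real \<Rightarrow> real \<Rightarrow> real \<Rightarrow> real \<Rightarrow> real \<Rightarrow> real \<Rightarrow> real \<Rightarrow>
   real \<Rightarrow> real \<Rightarrow> real \<Rightarrow> real \<Rightarrow> (real \<Rightarrow> real) \<Rightarrow> (real \<Rightarrow> real) \<Rightarrow>
   (real \<Rightarrow> real) \<Rightarrow> (real \<Rightarrow> real) \<Rightarrow> (real \<Rightarrow> real) \<Rightarrow> bool" where
  "chemostat_solution D a s_in \<alpha> c g r d \<alpha>1 \<alpha>2 r1 r2 \<mu> \<omega> s m1 m2 \<longleftrightarrow>
     (\<forall>t\<ge>0. s t \<ge> 0 \<and> m1 t \<ge> 0 \<and> m2 t \<ge> 0) \<and>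
     (\<forall>t\<ge>0.
        (s has_real_derivative
           (Drand D a \<omega> t * (s_in - \<alpha> * s t) - c * \<mu> (s t) * (m1 t + m2 t) + r * d * m1 t))
          (at t within {0..}) \<and>
        (m1 has_real_derivative
           (m1 t * (- d - \<alpha> * Drand D a \<omega> t + g * \<mu> (s t) - r1 * m1 t - r2 * m2 t - \<alpha>1)
            + \<alpha>2 * m2 t))
          (at t within {0..}) \<and>
        (m2 has_real_derivative
           (m2 t * (- d + g * \<mu> (s t) - r1 * m1 t - r2 * m2 t - \<alpha>2) + \<alpha>1 * m1 t))
          (at t within {0..}))"

end

theory Submission
  imports Defs
begin

text \<open>
  With \<open>m = m1 + m2\<close> and \<open>p = m1 / m\<close>, the nonlinear terms cancel in \<open>p'\<close> and
  \<open>p' \<ge> K (p* - p)\<close> for \<open>K = \<alpha>1 + \<alpha>2 + \<alpha> (D + a)\<close> and \<open>p* = \<alpha>2 / K\<close>. Hence \<open>p \<ge> p* - C exp (- K t)\<close>, and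
  \<open>(ln m)' \<le> g - d - \<alpha> p D(t)\<close> integrates to
  \<open>ln m(t) \<le> const + t (g - d - \<alpha> p* (1/t) \<integral> D(u) du)\<close>. The theorem follows once the time mean of the
  random dilution rate is almost surely \<open>D\<close>, that is, once the time mean of \<open>arctan \<xi>\<close> vanishes for the
  Ornstein--Uhlenbeck process \<open>\<xi>\<close>.

  For this ergodic property, \<open>\<xi>(t)\<close> differs by \<open>exp (- t) \<xi>(0)\<close> from the process \<open>\<zeta>\<close> started from 0. On a grid of
  width \<open>h\<close>, \<open>\<zeta>\<close> is uniformly approximated by the autoregression
  \<open>Z (k + 1) = exp (- h) Z k + (\<omega> ((k + 1) h) - \<omega> (k h))\<close>, whose \<open>arctan\<close> has exponentially decaying
  correlations. Letting \<open>h\<close> tend to 0, the second moment of \<open>\<integral> arctan \<zeta>\<close> over \<open>[0, n]\<close> is \<open>O(n)\<close>. So the time means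
  converge almost surely to 0 along the squares, and the boundedness of \<open>arctan\<close> fills the gaps.
\<close>

section \<open>Extinction under a time-averaged dilution rate\<close>

lemma has_real_derivative_nonneg_imp_le:
  fixes f f' :: "real \<Rightarrow> real"
  assumes der: "\<And>t. 0 \<le> t \<Longrightarrow> (f has_real_derivative f' t) (at t within {0..})"
    and nonneg: "\<And>t. 0 \<le> t \<Longrightarrow> 0 \<le> f' t"
    and "0 \<le> x" "x \<le> y"
  shows "f x \<le> f y"
proof (rule DERIV_nonneg_imp_increasing_open[OF \<open>x \<le> y\<close>])
  fix t assume t: "x < t" "t < y"
  then have "at t within {0..} = at t"
    using \<open>0 \<le> x\<close> by (intro at_within_interior) auto
  then show "\<exists>d. (f has_real_derivative d) (at t) \<and> 0 \<le> d"
    using der[of t] nonneg[of t] t \<open>0 \<le> x\<close> by auto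
next
  have "continuous_on {0..} f"
    by (rule DERIV_continuous_on) (use der in auto)
  then show "continuous_on {x..y} f"
    by (rule continuous_on_subset) (use \<open>0 \<le> x\<close> in auto)
qed

lemma total_biomass_tendsto_0:
  fixes m1 m2 \<delta> R F :: "real \<Rightarrow> real"
  assumes pos: "0 < \<alpha>" "0 \<le> \<alpha>1" "0 \<le> \<alpha>2" "0 < Dmax"
    and \<delta>: "\<And>t. 0 \<le> t \<Longrightarrow> 0 \<le> \<delta> t" "\<And>t. 0 \<le> t \<Longrightarrow> \<delta> t \<le> Dmax"
    and R: "\<And>t. 0 \<le> t \<Longrightarrow> R t \<le> \<rho>"
    and nonneg: "\<And>t. 0 \<le> t \<Longrightarrow> 0 \<le> m1 t" "\<And>t. 0 \<le> t \<Longrightarrow> 0 \<le> m2 t"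
    and m1: "\<And>t. 0 \<le> t \<Longrightarrow> (m1 has_real_derivative m1 t * (R t - \<alpha> * \<delta> t - \<alpha>1) + \<alpha>2 * m2 t) (at t within {0..})"
    and m2: "\<And>t. 0 \<le> t \<Longrightarrow> (m2 has_real_derivative m2 t * (R t - \<alpha>2) + \<alpha>1 * m1 t) (at t within {0..})"
    and F: "\<And>t. 0 \<le> t \<Longrightarrow> (F has_real_derivative \<delta> t) (at t within {0..})"
    and mean: "((\<lambda>t. F t / t) \<longlongrightarrow> D) at_top"
    and cond: "\<rho> < \<alpha> * D * (\<alpha>2 / (\<alpha>1 + \<alpha>2 + \<alpha> * Dmax))"
  shows "((\<lambda>t. m1 t + m2 t) \<longlongrightarrow> 0) at_top"
proof -
  define m where "m = (\<lambda>t. m1 t + m2 t)"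
  have m_nonneg: "0 \<le> m t" if "0 \<le> t" for t using nonneg that by (auto simp: m_def)
  have m: "(m has_real_derivative m t * R t - \<alpha> * \<delta> t * m1 t) (at t within {0..})" if "0 \<le> t" for t
    unfolding m_def by (rule derivative_eq_intros m1 m2 that refl)+ (simp add: algebra_simps)
  define K where "K = \<alpha>1 + \<alpha>2 + \<alpha> * Dmax"
  have "K > 0" using pos by (auto simp: K_def intro!: add_nonneg_pos)
  define ps where "ps = \<alpha>2 / K"
  have "(m \<longlongrightarrow> 0) at_top"
  proof (cases "\<exists>t0\<ge>0. m t0 = 0")
    case True
    then obtain t0 where t0: "0 \<le> t0" "m t0 = 0" by blast
    have le: "- (m t0 * exp (- \<rho> * t0)) \<le> - (m t * exp (- \<rho> * t))" if "t0 \<le> t" for t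
    proof (rule has_real_derivative_nonneg_imp_le[OF _ _ t0(1) that])
      fix t :: real assume t: "0 \<le> t"
      show "((\<lambda>t. - (m t * exp (- \<rho> * t))) has_real_derivative
         (\<rho> * m t - (m t * R t - \<alpha> * \<delta> t * m1 t)) * exp (- \<rho> * t)) (at t within {0..})"
        by (rule derivative_eq_intros m t refl)+ (simp add: algebra_simps)
      have "m t * R t \<le> m t * \<rho>" "0 \<le> \<alpha> * \<delta> t * m1 t"
        using R t m_nonneg nonneg \<delta> pos by (auto intro!: mult_left_mono mult_nonneg_nonneg)
      then show "0 \<le> (\<rho> * m t - (m t * R t - \<alpha> * \<delta> t * m1 t)) * exp (- \<rho> * t)"
        by (intro mult_nonneg_nonneg) (auto simp: algebra_simps)
    qed
    have "m t = 0" if "t0 \<le> t" for t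
    proof -
      have "m t * exp (- \<rho> * t) \<le> 0" using le[OF that] t0 by simp
      then show ?thesis using m_nonneg[of t] that t0
        by (simp add: mult_le_0_iff)
    qed
    then have "eventually (\<lambda>t. m t = 0) at_top"
      by (auto simp: eventually_at_top_linorder)
    then show ?thesis by (rule tendsto_eventually)
  next
    case False
    then have m_pos: "0 < m t" if "0 \<le> t" for t using m_nonneg[OF that] that by (force simp: order_less_le)
    define p where "p = (\<lambda>t. m1 t / m t)"
    have p01: "0 \<le> p t" "p t * m t = m1 t" if "0 \<le> t" for t
      using nonneg(1)[OF that] m_pos[OF that] by (auto simp: p_def)
    have p: "(p has_real_derivative \<alpha>2 - (\<alpha>1 + \<alpha>2) * p t - \<alpha> * \<delta> t * p t + \<alpha> * \<delta> t * (p t)\<^sup>2) (at t within {0..})"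
      if t: "0 \<le> t" for t
    proof -
      have ne: "m t \<noteq> 0" using m_pos[OF t] by simp
      have m2e: "m2 t = m t - m1 t" by (simp add: m_def)
      show ?thesis
        unfolding p_def
        apply (rule DERIV_cong[OF DERIV_divide[OF m1[OF t] m[OF t] ne]])
        unfolding m2e using ne by (simp add: field_simps power2_eq_square)
    qed
    define C where "C = \<bar>ps - p 0\<bar>"
    have p_lower: "ps - C * exp (- K * t) \<le> p t" if "0 \<le> t" for t
    proof -
      have "(p 0 - ps) * exp (K * 0) \<le> (p t - ps) * exp (K * t)"
      proof (rule has_real_derivative_nonneg_imp_le[OF _ _ order_refl that])
        fix t :: real assume t: "0 \<le> t"
        show "((\<lambda>t. (p t - ps) * exp (K * t)) has_real_derivative
          ((\<alpha>2 - (\<alpha>1 + \<alpha>2) * p t - \<alpha> * \<delta> t * p t + \<alpha> * \<delta> t * (p t)\<^sup>2) + K * (p t - ps)) * exp (K * t)) (at t within {0..})"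
          by (rule derivative_eq_intros p t refl)+ (simp add: algebra_simps)
        have 1: "K * ps = \<alpha>2" using \<open>K > 0\<close> by (simp add: ps_def)
        have 2: "\<alpha> * \<delta> t * p t \<le> \<alpha> * Dmax * p t"
          using \<delta> t pos p01[OF t] by (intro mult_right_mono mult_left_mono) auto
        have 3: "0 \<le> \<alpha> * \<delta> t * (p t)\<^sup>2"
          using \<delta> t pos by (intro mult_nonneg_nonneg) auto
        have "0 \<le> (\<alpha>2 - (\<alpha>1 + \<alpha>2) * p t - \<alpha> * \<delta> t * p t + \<alpha> * \<delta> t * (p t)\<^sup>2) + (K * p t - K * ps)"
          unfolding 1 using 2 3 by (simp add: K_def algebra_simps)
        then show "0 \<le> ((\<alpha>2 - (\<alpha>1 + \<alpha>2) * p t - \<alpha> * \<delta> t * p t + \<alpha> * \<delta> t * (p t)\<^sup>2) + K * (p t - ps)) * exp (K * t)"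
          by (intro mult_nonneg_nonneg) (auto simp: right_diff_distrib)
      qed
      then have "- C \<le> (p t - ps) * exp (K * t)" unfolding C_def by simp
      then have "- C * exp (- K * t) \<le> (p t - ps) * exp (K * t) * exp (- K * t)"
        by (rule mult_right_mono) simp
      then show ?thesis by (simp add: mult.assoc flip: exp_add)
    qed
    define C1 where "C1 = \<alpha> * Dmax * C / K"
    have C1: "0 \<le> C1" "C1 * K = \<alpha> * Dmax * C"
      using pos \<open>K > 0\<close> by (auto simp: C1_def C_def)
    define G where "G = (\<lambda>t. ln (m t) - \<rho> * t + \<alpha> * ps * F t + C1 * exp (- K * t))"
    have G_le: "- G 0 \<le> - G t" if "0 \<le> t" for t
    proof (rule has_real_derivative_nonneg_imp_le[OF _ _ order_refl that])
      fix t :: real assume t: "0 \<le> t"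
      show "((\<lambda>t. - G t) has_real_derivative
          - ((m t * R t - \<alpha> * \<delta> t * m1 t) / m t - \<rho> + \<alpha> * ps * \<delta> t - C1 * K * exp (- K * t))) (at t within {0..})"
        unfolding G_def
        by (rule derivative_eq_intros m F t m_pos refl)+ (use m_pos[OF t] in \<open>simp add: field_simps\<close>)
      have 1: "(m t * R t - \<alpha> * \<delta> t * m1 t) / m t = R t - \<alpha> * \<delta> t * p t"
        using m_pos[OF t] by (simp add: p_def field_simps)
      have "\<alpha> * \<delta> t * (ps - p t) \<le> \<alpha> * \<delta> t * (C * exp (- K * t))"
        using p_lower[OF t] \<delta> t pos by (intro mult_left_mono mult_nonneg_nonneg) (auto simp: algebra_simps)
      also have "\<dots> \<le> \<alpha> * Dmax * (C * exp (- K * t))"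
        using \<delta> t pos by (intro mult_left_mono mult_right_mono mult_nonneg_nonneg) (auto simp: C_def)
      finally show "0 \<le> - ((m t * R t - \<alpha> * \<delta> t * m1 t) / m t - \<rho> + \<alpha> * ps * \<delta> t - C1 * K * exp (- K * t))"
        unfolding 1 C1(2) using R[OF t] by (simp add: algebra_simps)
    qed
    have bound: "m t \<le> exp (G 0 + (\<rho> - \<alpha> * ps * (F t / t)) * t)" if t: "0 < t" for t
    proof -
      have e0: "0 \<le> C1 * exp (- K * t)" using C1 by simp
      have Ge: "G t = ln (m t) - \<rho> * t + \<alpha> * ps * F t + C1 * exp (- K * t)" by (simp add: G_def)
      have rhs: "(\<rho> - \<alpha> * ps * (F t / t)) * t = \<rho> * t - \<alpha> * ps * F t"
        using t by (simp add: field_simps)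
      have "ln (m t) \<le> G 0 + (\<rho> - \<alpha> * ps * (F t / t)) * t"
        using G_le[of t] t e0 Ge rhs by linarith
      then show ?thesis using m_pos[of t] t by (metis exp_le_cancel_iff exp_ln less_imp_le)
    qed
    have lim: "((\<lambda>t. \<rho> - \<alpha> * ps * (F t / t)) \<longlongrightarrow> \<rho> - \<alpha> * ps * D) at_top"
      by (intro tendsto_intros mean)
    have neg: "\<rho> - \<alpha> * ps * D < 0" using cond by (simp add: ps_def K_def mult_ac)
    have "LIM t at_top. (\<rho> - \<alpha> * ps * (F t / t)) * t :> at_bot"
      by (rule filterlim_tendsto_neg_mult_at_bot[OF lim neg filterlim_ident])
    then have "LIM t at_top. G 0 + (\<rho> - \<alpha> * ps * (F t / t)) * t :> at_bot"
      by (rule filterlim_tendsto_add_at_bot_iff[OF tendsto_const, THEN iffD2])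
    then have "((\<lambda>t. exp (G 0 + (\<rho> - \<alpha> * ps * (F t / t)) * t)) \<longlongrightarrow> 0) at_top"
      by (rule filterlim_compose[OF exp_at_bot])
    then show ?thesis
    proof (rule tendsto_sandwich[OF _ _ tendsto_const, rotated 2])
      show "eventually (\<lambda>t. 0 \<le> m t) at_top"
        using eventually_ge_at_top[of 0] by eventually_elim (rule m_nonneg)
      show "eventually (\<lambda>t. m t \<le> exp (G 0 + (\<rho> - \<alpha> * ps * (F t / t)) * t)) at_top"
        using eventually_gt_at_top[of 0] by eventually_elim (rule bound)
    qed
  qed
  then show ?thesis by (simp add: m_def)
qed

section \<open>Pathwise properties of the Ornstein--Uhlenbeck process\<close>

lemma abs_arctan_diff_le: "\<bar>arctan x - arctan y\<bar> \<le> \<bar>x - y\<bar>"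
proof -
  have *: "x - arctan x \<le> y - arctan y" if "x \<le> y" for x y :: real
  proof (rule DERIV_nonneg_imp_nondecreasing[OF that], intro exI conjI)
    fix t :: real
    show "((\<lambda>x. x - arctan x) has_real_derivative 1 - inverse (1 + t\<^sup>2)) (at t)"
      by (auto intro!: derivative_eq_intros)
    show "0 \<le> 1 - inverse (1 + t\<^sup>2)" by (simp add: inverse_le_1_iff)
  qed
  show ?thesis
  proof (cases "x \<le> y")
    case True
    then show ?thesis using *[of x y] arctan_le_iff[of x y] by simp
  next
    case False
    then show ?thesis using *[of y x] arctan_le_iff[of y x] by simp
  qed
qed

lemma abs_arctan_le_half_pi: "\<bar>arctan x\<bar> \<le> pi / 2"
  using arctan_bounded[of x] by auto

lemma integral_has_real_derivative_atLeast:
  fixes f :: "real \<Rightarrow> real"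
  assumes "continuous_on {0..} f" "0 \<le> t"
  shows "((\<lambda>t. integral {0..t} f) has_real_derivative f t) (at t within {0..})"
proof -
  have "((\<lambda>t. integral {0..t} f) has_real_derivative f t) (at t within {0..t+1})"
    by (rule integral_has_real_derivative)
       (use assms in \<open>auto intro: continuous_on_subset\<close>)
  also have "at t within {0..t+1} = at t within {0..}"
    by (rule at_within_nhd[of _ "{..<t+1}"]) auto
  finally show ?thesis .
qed

text \<open>The stochastic integral of \<open>exp (u - t)\<close> against \<open>d\<omega>(u)\<close> over \<open>[0, t]\<close>, integrated by parts:
  the Ornstein--Uhlenbeck process started from 0.\<close>

definition ou_zero :: "(real \<Rightarrow> real) \<Rightarrow> real \<Rightarrow> real" where
  "ou_zero \<omega> t = \<omega> t - exp (- t) * integral {0..t} (\<lambda>u. exp u * \<omega> u)"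

primrec ar1 :: "real \<Rightarrow> (nat \<Rightarrow> real) \<Rightarrow> nat \<Rightarrow> real" where
  "ar1 q x 0 = 0"
| "ar1 q x (Suc k) = q * ar1 q x k + x k"

lemma ou_zero_increment:
  assumes cont: "continuous_on UNIV \<omega>" and "0 \<le> t" "0 \<le> h"
    and osc: "\<And>u. u \<in> {t..t + h} \<Longrightarrow> \<bar>\<omega> u - \<omega> t\<bar> \<le> \<epsilon>"
  shows "\<bar>ou_zero \<omega> (t + h) - exp (- h) * ou_zero \<omega> t - (\<omega> (t + h) - \<omega> t)\<bar> \<le> (1 - exp (- h)) * \<epsilon>"
proof -
  have c: "continuous_on S \<omega>" for S using cont continuous_on_subset by blast
  have int: "(\<lambda>u. exp u * \<omega> u) integrable_on {a..b}" for a b :: real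
    by (intro integrable_continuous_real continuous_intros c)
  have comb: "integral {0..t + h} (\<lambda>u. exp u * \<omega> u) =
      integral {0..t} (\<lambda>u. exp u * \<omega> u) + integral {t..t + h} (\<lambda>u. exp u * \<omega> u)"
    using assms int by (simp add: Henstock_Kurzweil_Integration.integral_combine)
  have expI: "(exp has_integral exp (t + h) - exp t) {t..t + h}"
    using \<open>0 \<le> h\<close>
    by (intro fundamental_theorem_of_calculus)
       (auto intro!: derivative_eq_intros simp flip: has_real_derivative_iff_has_vector_derivative)
  define J where "J = integral {t..t + h} (\<lambda>u. exp u * (\<omega> u - \<omega> t))"
  have J: "J = integral {t..t + h} (\<lambda>u. exp u * \<omega> u) - (exp (t + h) - exp t) * \<omega> t"
    unfolding J_def right_diff_distrib using expI
    by (subst Henstock_Kurzweil_Integration.integral_diff)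
       (auto simp: has_integral_iff int intro!: integrable_continuous_real continuous_intros)
  have "\<bar>J\<bar> \<le> integral {t..t + h} (\<lambda>u. exp u * \<epsilon>)"
    unfolding J_def real_norm_def[symmetric]
    by (intro integral_norm_bound_integral integrable_continuous_real continuous_intros c)
       (auto simp: abs_mult osc)
  also have "\<dots> = (exp (t + h) - exp t) * \<epsilon>"
    using expI by (auto simp: has_integral_iff)
  finally have "exp (- (t + h)) * \<bar>J\<bar> \<le> exp (- (t + h)) * ((exp (t + h) - exp t) * \<epsilon>)"
    by (rule mult_left_mono) simp
  also have "\<dots> = (1 - exp (- h)) * \<epsilon>"
    by (simp add: algebra_simps flip: exp_add)
  finally have 1: "\<bar>exp (- (t + h)) * J\<bar> \<le> (1 - exp (- h)) * \<epsilon>"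
    by (simp add: abs_mult)
  have e1: "exp (- h) * exp (- t) = exp (- (t + h))" "exp (- (t + h)) * exp (t + h) = 1"
    "exp (- (t + h)) * exp t = exp (- h)" by (simp_all flip: exp_add)
  have "exp (- (t + h)) * J = exp (- (t + h)) * integral {t..t + h} (\<lambda>u. exp u * \<omega> u)
      - (exp (- (t + h)) * exp (t + h) - exp (- (t + h)) * exp t) * \<omega> t"
    unfolding J by (simp only: right_diff_distrib left_diff_distrib mult.assoc)
  then have eq: "exp (- (t + h)) * J = exp (- (t + h)) * integral {t..t + h} (\<lambda>u. exp u * \<omega> u) - (1 - exp (- h)) * \<omega> t"
    unfolding e1 .
  have "ou_zero \<omega> (t + h) - exp (- h) * ou_zero \<omega> t - (\<omega> (t + h) - \<omega> t) = - (exp (- (t + h)) * J)"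
    unfolding eq unfolding ou_zero_def comb e1(1)[symmetric] by (simp add: algebra_simps)
  then show ?thesis using 1 by simp
qed

lemma ar1_approximates_ou_zero:
  assumes cont: "continuous_on UNIV \<omega>" "\<omega> 0 = 0" and "0 \<le> h" "0 \<le> \<epsilon>"
    and osc: "\<And>i u. i < k \<Longrightarrow> u \<in> {real i * h..real i * h + h} \<Longrightarrow> \<bar>\<omega> u - \<omega> (real i * h)\<bar> \<le> \<epsilon>"
  shows "\<bar>ou_zero \<omega> (real k * h) - ar1 (exp (- h)) (\<lambda>i. \<omega> (real (Suc i) * h) - \<omega> (real i * h)) k\<bar> \<le> \<epsilon>"
  using osc
proof (induction k)
  case 0
  then show ?case using assms by (simp add: ou_zero_def)
next
  case (Suc k)
  let ?Z = "ar1 (exp (- h)) (\<lambda>i. \<omega> (real (Suc i) * h) - \<omega> (real i * h))"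
  have S: "real (Suc k) * h = real k * h + h" by (simp add: algebra_simps)
  have IH: "\<bar>ou_zero \<omega> (real k * h) - ?Z k\<bar> \<le> \<epsilon>" using Suc by simp
  then have "exp (- h) * \<bar>ou_zero \<omega> (real k * h) - ?Z k\<bar> \<le> exp (- h) * \<epsilon>"
    by (rule mult_left_mono) simp
  then have 1: "\<bar>exp (- h) * (ou_zero \<omega> (real k * h) - ?Z k)\<bar> \<le> exp (- h) * \<epsilon>" by (simp add: abs_mult)
  have 2: "\<bar>ou_zero \<omega> (real k * h + h) - exp (- h) * ou_zero \<omega> (real k * h) - (\<omega> (real k * h + h) - \<omega> (real k * h))\<bar>
      \<le> (1 - exp (- h)) * \<epsilon>"
    by (rule ou_zero_increment) (use assms Suc.prems in auto)
  have "ou_zero \<omega> (real k * h + h) - ?Z (Suc k) = exp (- h) * (ou_zero \<omega> (real k * h) - ?Z k)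
      + (ou_zero \<omega> (real k * h + h) - exp (- h) * ou_zero \<omega> (real k * h) - (\<omega> (real k * h + h) - \<omega> (real k * h)))"
    by (simp add: algebra_simps)
  also have "\<bar>\<dots>\<bar> \<le> exp (- h) * \<epsilon> + (1 - exp (- h)) * \<epsilon>"
    by (rule order_trans[OF abs_triangle_ineq add_mono[OF 1 2]])
  finally show ?case unfolding S by (simp add: algebra_simps)
qed

lemma integral_approximates_sum:
  fixes f :: "real \<Rightarrow> real"
  assumes cont: "continuous_on {0..} f" and "0 \<le> h"
    and osc: "\<And>i u. i < k \<Longrightarrow> u \<in> {real i * h..real i * h + h} \<Longrightarrow> \<bar>f u - a i\<bar> \<le> \<epsilon>"
  shows "\<bar>integral {0..real k * h} f - h * (\<Sum>i<k. a i)\<bar> \<le> real k * h * \<epsilon>"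
  using osc
proof (induction k)
  case 0
  then show ?case by simp
next
  case (Suc k)
  have S: "real (Suc k) * h = real k * h + h" by (simp add: algebra_simps)
  have kh: "0 \<le> real k * h" using \<open>0 \<le> h\<close> by simp
  have int: "f integrable_on {x..y}" if "0 \<le> x" for x y
    by (rule integrable_continuous_real, rule continuous_on_subset[OF cont]) (use that in auto)
  have comb: "integral {0..real k * h + h} f = integral {0..real k * h} f + integral {real k * h..real k * h + h} f"
    using \<open>0 \<le> h\<close> kh int by (intro Henstock_Kurzweil_Integration.integral_combine[symmetric]) auto
  have "\<bar>integral {real k * h..real k * h + h} (\<lambda>u. f u - a k)\<bar> \<le> integral {real k * h..real k * h + h} (\<lambda>u. \<epsilon>)"
    unfolding real_norm_def[symmetric]
    by (intro integral_norm_bound_integral integrable_diff int kh) (use Suc.prems in auto)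
  moreover have "integral {real k * h..real k * h + h} (\<lambda>u. f u - a k) = integral {real k * h..real k * h + h} f - h * a k"
    using \<open>0 \<le> h\<close> kh int by (subst Henstock_Kurzweil_Integration.integral_diff) auto
  ultimately have 1: "\<bar>integral {real k * h..real k * h + h} f - h * a k\<bar> \<le> h * \<epsilon>"
    using \<open>0 \<le> h\<close> by simp
  have 2: "\<bar>integral {0..real k * h} f - h * (\<Sum>i<k. a i)\<bar> \<le> real k * h * \<epsilon>"
    using Suc by simp
  show ?case unfolding S comb using 1 2 by (simp add: algebra_simps abs_le_iff)
qed

lemma continuous_on_ou_zero:
  assumes "continuous_on UNIV \<omega>"
  shows "continuous_on {0..} (ou_zero \<omega>)"
proof -
  have c: "continuous_on S \<omega>" for S using assms continuous_on_subset by blast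
  have "continuous_on {0..} (\<lambda>t. integral {0..t} (\<lambda>u. exp u * \<omega> u))"
    by (rule DERIV_continuous_on, rule integral_has_real_derivative_atLeast)
       (auto intro!: continuous_intros c)
  then show ?thesis unfolding ou_zero_def by (intro continuous_intros c)
qed

lemma riemann_sum_tendsto_integral_arctan_ou_zero:
  fixes n :: nat
  assumes cont: "continuous_on UNIV \<omega>" "\<omega> 0 = 0"
  shows "(\<lambda>N. inverse (real N) * (\<Sum>k<N * n. arctan (ar1 (exp (- inverse (real N)))
           (\<lambda>i. \<omega> (real (Suc i) * inverse (real N)) - \<omega> (real i * inverse (real N))) k)))
         \<longlonglongrightarrow> integral {0..real n} (\<lambda>t. arctan (ou_zero \<omega> t))"
proof (rule LIMSEQ_I)
  fix e :: real assume "0 < e"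
  define \<epsilon> where "\<epsilon> = e / (2 * (real n + 1))"
  have "0 < \<epsilon>" using \<open>0 < e\<close> by (auto simp: \<epsilon>_def)
  have uc1: "uniformly_continuous_on {0..real n} \<omega>"
    by (intro compact_uniformly_continuous continuous_on_subset[OF cont(1)]) auto
  have uc2: "uniformly_continuous_on {0..real n} (ou_zero \<omega>)"
    by (intro compact_uniformly_continuous continuous_on_subset[OF continuous_on_ou_zero[OF cont(1)]]) auto
  obtain d1 where d1: "d1 > 0" "\<And>x y. x \<in> {0..real n} \<Longrightarrow> y \<in> {0..real n} \<Longrightarrow> dist y x < d1 \<Longrightarrow> dist (\<omega> y) (\<omega> x) < \<epsilon>"
    using uc1 \<open>0 < \<epsilon>\<close> unfolding uniformly_continuous_on_def by meson
  obtain d2 where d2: "d2 > 0" "\<And>x y. x \<in> {0..real n} \<Longrightarrow> y \<in> {0..real n} \<Longrightarrow> dist y x < d2 \<Longrightarrow> dist (ou_zero \<omega> y) (ou_zero \<omega> x) < \<epsilon>"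
    using uc2 \<open>0 < \<epsilon>\<close> unfolding uniformly_continuous_on_def by meson
  obtain N0 where N0: "N0 \<noteq> 0" "inverse (real N0) < min d1 d2"
    using ex_inverse_of_nat_less[of "min d1 d2"] d1(1) d2(1) by auto
  show "\<exists>no. \<forall>N\<ge>no. norm (inverse (real N) * (\<Sum>k<N * n. arctan (ar1 (exp (- inverse (real N)))
           (\<lambda>i. \<omega> (real (Suc i) * inverse (real N)) - \<omega> (real i * inverse (real N))) k))
        - integral {0..real n} (\<lambda>t. arctan (ou_zero \<omega> t))) < e"
  proof (intro exI[of _ N0] allI impI)
    fix N assume "N0 \<le> N"
    then have N: "0 < N" using N0 by auto
    define h where "h = inverse (real N)"
    have h: "0 < h" "real N * h = 1" using N by (auto simp: h_def)
    have "h \<le> inverse (real N0)" unfolding h_def using \<open>N0 \<le> N\<close> N0(1) by (intro le_imp_inverse_le) auto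
    then have hd: "h < d1" "h < d2" using N0 by auto
    let ?Z = "ar1 (exp (- h)) (\<lambda>i. \<omega> (real (Suc i) * h) - \<omega> (real i * h))"
    have dom: "u \<in> {0..real n}" "real i * h \<in> {0..real n}" "\<bar>u - real i * h\<bar> \<le> h"
      if "i < N * n" "u \<in> {real i * h..real i * h + h}" for i u
    proof -
      have "real i + 1 \<le> real N * real n" using that(1) by (metis Suc_leI of_nat_Suc add.commute of_nat_le_iff of_nat_mult)
      then have "(real i + 1) * h \<le> real N * real n * h" using h by (intro mult_right_mono) auto
      also have "\<dots> = real n" using h(2) by (simp add: mult_ac)
      finally have "real i * h + h \<le> real n" by (simp add: algebra_simps)
      moreover have "0 \<le> real i * h" using h by simp
      ultimately show "u \<in> {0..real n}" "real i * h \<in> {0..real n}" "\<bar>u - real i * h\<bar> \<le> h"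
        using that(2) h unfolding atLeastAtMost_iff abs_le_iff by linarith+
    qed
    have "\<bar>arctan (ou_zero \<omega> u) - arctan (?Z i)\<bar> \<le> 2 * \<epsilon>" if i: "i < N * n" "u \<in> {real i * h..real i * h + h}" for i u
    proof -
      have 1: "\<bar>ou_zero \<omega> (real i * h) - ?Z i\<bar> \<le> \<epsilon>"
      proof (rule ar1_approximates_ou_zero[OF cont])
        fix j v assume j: "j < i" "v \<in> {real j * h..real j * h + h}"
        then have "j < N * n" using i by simp
        then have "dist (\<omega> v) (\<omega> (real j * h)) < \<epsilon>"
          using dom[OF _ j(2)] hd by (intro d1(2)) (auto simp: dist_real_def)
        then show "\<bar>\<omega> v - \<omega> (real j * h)\<bar> \<le> \<epsilon>" by (simp add: dist_real_def)
      qed (use h \<open>0 < \<epsilon>\<close> in auto)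
      have "dist (ou_zero \<omega> u) (ou_zero \<omega> (real i * h)) < \<epsilon>"
        using dom[OF i] hd by (intro d2(2)) (auto simp: dist_real_def)
      then have "\<bar>ou_zero \<omega> u - ?Z i\<bar> \<le> 2 * \<epsilon>" using 1 by (auto simp: dist_real_def abs_le_iff)
      then show ?thesis using abs_arctan_diff_le order_trans by blast
    qed
    then have approx: "\<bar>integral {0..real (N * n) * h} (\<lambda>t. arctan (ou_zero \<omega> t)) - h * (\<Sum>i<N * n. arctan (?Z i))\<bar> \<le> real (N * n) * h * (2 * \<epsilon>)"
      using h by (intro integral_approximates_sum continuous_on_arctan continuous_on_ou_zero cont) auto
    have Nh: "real (N * n) * h = real n" using h(2) by (simp add: mult_ac)
    have "real n * (2 * \<epsilon>) < e" using \<open>0 < e\<close> by (simp add: \<epsilon>_def field_simps)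
    with approx[unfolded Nh] show "norm (inverse (real N) * (\<Sum>k<N * n. arctan (ar1 (exp (- inverse (real N)))
           (\<lambda>i. \<omega> (real (Suc i) * inverse (real N)) - \<omega> (real i * inverse (real N))) k))
        - integral {0..real n} (\<lambda>t. arctan (ou_zero \<omega> t))) < e"
      unfolding h_def[symmetric] real_norm_def by (subst abs_minus_commute) (rule order_le_less_trans)
  qed
qed

lemma exp_lborel_integral_atMost_0:
  "set_integrable lborel {..0} (exp :: real \<Rightarrow> real)" "(LINT s:{..0}|lborel. exp s) = (1 :: real)"
proof -
  have "(\<integral>\<^sup>+s. ennreal (indicator {0..} s * exp (- s)) \<partial>lborel) =
     (\<integral>\<^sup>+s. ennreal (exp (- s)) * indicator {0..} s \<partial>lborel)"
    by (intro nn_integral_cong) (auto split: split_indicator)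
  also have "\<dots> = 0 - (- exp (- 0 :: real))"
  proof (rule nn_integral_FTC_atLeast)
    show "((\<lambda>x::real. - exp (- x)) \<longlongrightarrow> 0) at_top"
      by (rule tendsto_eq_intros filterlim_compose[OF exp_at_bot filterlim_uminus_at_bot_at_top] | simp)+
  qed (auto intro!: derivative_eq_intros)
  finally have "has_bochner_integral lborel (\<lambda>s::real. indicator {0..} s * exp (- s)) (1::real)"
    by (intro has_bochner_integral_nn_integral) auto
  then have 1: "integrable lborel (\<lambda>s::real. indicator {0..} s * exp (- s))"
    "(\<integral>s. indicator {0..} s * exp (- s) \<partial>lborel) = (1::real)"
    by (auto simp: has_bochner_integral_iff)
  have eq: "(\<lambda>s::real. indicator {..0} s * exp s) = (\<lambda>s. indicator {0..} (0 + (-1) * s) * exp (- (0 + (-1) * s)))"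
    by (auto split: split_indicator)
  show "set_integrable lborel {..0} (exp :: real \<Rightarrow> real)"
    unfolding set_integrable_def real_scaleR_def eq
    by (rule lborel_integrable_real_affine[OF 1(1)]) simp
  show "(LINT s:{..0}|lborel. exp s) = (1 :: real)"
    unfolding set_lebesgue_integral_def real_scaleR_def eq
    using lborel_integral_real_affine[of "-1" "\<lambda>s. indicator {0..} s * exp (- s)" 0] 1(2) by simp
qed

text \<open>If \<open>exp s * \<omega> s\<close> is not integrable at \<open>-\<infinity>\<close>, the integral defining \<^const>\<open>OU\<close> takes the junk
  value 0 along the whole orbit, so no almost sure growth bound for \<open>\<omega>\<close> is needed.\<close>

lemma OU_wiener_shift_cases:
  assumes cont: "continuous_on UNIV \<omega>" and "\<omega> 0 = 0"
  obtains "\<And>t. 0 \<le> t \<Longrightarrow> OU (wiener_shift t \<omega>) = 0"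
    | "\<And>t. 0 \<le> t \<Longrightarrow> OU (wiener_shift t \<omega>) = exp (- t) * OU \<omega> + ou_zero \<omega> t"
proof -
  let ?g = "\<lambda>u. exp u * \<omega> u"
  have shift_eq: "indicator {..0} s *\<^sub>R (exp s * \<omega> (s + t)) = exp (- t) * (indicator {..t} (t + 1 * s) *\<^sub>R ?g (t + 1 * s))" for s t
    by (simp add: exp_add add.commute mult_ac split: split_indicator flip: exp_minus)
      (simp add: exp_minus)
  have shift_int: "set_integrable lborel {..0} (\<lambda>s. exp s * \<omega> (s + t)) \<longleftrightarrow> set_integrable lborel {..t} ?g" for t
    unfolding set_integrable_def shift_eq
    using lborel_integrable_real_affine_iff[of 1 "\<lambda>u. indicator {..t} u *\<^sub>R ?g u" t] by simp
  have shift_val: "(LINT s:{..0}|lborel. exp s * \<omega> (s + t)) = exp (- t) * (LINT u:{..t}|lborel. ?g u)" for t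
    unfolding set_lebesgue_integral_def shift_eq
    using lborel_integral_real_affine[of 1 "\<lambda>u. indicator {..t} u *\<^sub>R ?g u" t] by simp
  have OU_eq: "wiener_shift t \<omega> s = \<omega> (s + t) - \<omega> t" for s t by (simp add: wiener_shift_def)
  have const: "set_integrable lborel {..0} (\<lambda>s. exp s * c)" for c :: real
    using exp_lborel_integral_atMost_0(1) by (intro set_integrable_mult_left) auto
  show thesis
  proof (cases "set_integrable lborel {..0} ?g")
    case False
    have "OU (wiener_shift t \<omega>) = 0" if t: "0 \<le> t" for t
    proof -
      have "\<not> set_integrable lborel {..0} (\<lambda>s. exp s * (\<omega> (s + t) - \<omega> t))"
      proof
        assume "set_integrable lborel {..0} (\<lambda>s. exp s * (\<omega> (s + t) - \<omega> t))"
        from set_integral_add(1)[OF this const[of "\<omega> t"]]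
        have "set_integrable lborel {..0} (\<lambda>s. exp s * \<omega> (s + t))" by (simp add: algebra_simps)
        then have "set_integrable lborel {..0} ?g"
          unfolding shift_int by (rule set_integrable_subset) (use t in auto)
        then show False using False by simp
      qed
      then show ?thesis
        by (simp add: OU_def OU_eq set_lebesgue_integral_def set_integrable_def not_integrable_integral_eq)
    qed
    then show thesis by (rule that(1))
  next
    case True
    have "OU (wiener_shift t \<omega>) = exp (- t) * OU \<omega> + ou_zero \<omega> t" if t: "0 \<le> t" for t
    proof -
      have c: "continuous_on S \<omega>" for S using cont continuous_on_subset by blast
      have int0: "set_integrable lborel {0..t} ?g"
        by (intro borel_integrable_atLeastAtMost' continuous_intros c)
      have int1: "set_integrable lborel {0<..t} ?g"
        by (rule set_integrable_subset[OF int0]) auto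
      have U: "{..t} = {..0} \<union> {0<..t}" using t by auto
      have intU: "set_integrable lborel {..t} ?g"
        unfolding U by (rule set_integrable_Un[OF True int1]) auto
      have "(LINT u:{..t}|lborel. ?g u) = (LINT u:{..0}|lborel. ?g u) + (LINT u:{0<..t}|lborel. ?g u)"
        unfolding U by (rule set_integral_Un[OF _ True int1]) auto
      also have "(LINT u:{0<..t}|lborel. ?g u) = (LINT u:{0..t}|lborel. ?g u)"
      proof -
        have "AE x in lborel. x \<noteq> (0::real)" by (rule AE_lborel_singleton)
        then have "AE x in lborel. indicator {0<..t} x *\<^sub>R ?g x = indicator {0..t} x *\<^sub>R ?g x"
          by eventually_elim (auto split: split_indicator)
        moreover have "(\<lambda>x. indicator {0<..t} x *\<^sub>R ?g x) \<in> borel_measurable lborel"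
          "(\<lambda>x. indicator {0..t} x *\<^sub>R ?g x) \<in> borel_measurable lborel"
          using int0 int1 by (auto simp: set_integrable_def dest: borel_measurable_integrable)
        ultimately show ?thesis
          unfolding set_lebesgue_integral_def by (intro integral_cong_AE)
      qed
      also have "\<dots> = integral {0..t} ?g" by (rule set_borel_integral_eq_integral(2)[OF int0])
      finally have val: "(LINT u:{..t}|lborel. ?g u) = - OU \<omega> + integral {0..t} ?g" by (simp add: OU_def)
      have "OU (wiener_shift t \<omega>) = - (LINT s:{..0}|lborel. exp s * \<omega> (s + t) - exp s * \<omega> t)"
        by (simp add: OU_def OU_eq right_diff_distrib)
      also have "\<dots> = - ((LINT s:{..0}|lborel. exp s * \<omega> (s + t)) - (LINT s:{..0}|lborel. exp s * \<omega> t))"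
        using set_integral_diff(2)[OF _ const] intU by (simp only: shift_int)
      also have "\<dots> = exp (- t) * OU \<omega> + ou_zero \<omega> t"
        by (simp add: shift_val val exp_lborel_integral_atMost_0 ou_zero_def algebra_simps)
      finally show ?thesis .
    qed
    then show thesis by (rule that(2))
  qed
qed

lemma continuous_on_OU_wiener_shift:
  assumes "continuous_on UNIV \<omega>" "\<omega> 0 = 0"
  shows "continuous_on {0..} (\<lambda>t. OU (wiener_shift t \<omega>))"
  using assms
proof (cases rule: OU_wiener_shift_cases)
  case 1
  then show ?thesis by (subst continuous_on_cong[OF refl, where g="\<lambda>_. 0"]) auto
next
  case 2
  have "continuous_on {0..} (\<lambda>t. exp (- t) * OU \<omega> + ou_zero \<omega> t)"
    by (intro continuous_intros continuous_on_ou_zero assms)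
  then show ?thesis by (subst continuous_on_cong[OF refl 2]) auto
qed

lemma mean_arctan_OU_tendsto_0:
  assumes cont: "continuous_on UNIV \<omega>" "\<omega> 0 = 0"
    and lim: "((\<lambda>T. integral {0..T} (\<lambda>t. arctan (ou_zero \<omega> t)) / T) \<longlongrightarrow> 0) at_top"
  shows "((\<lambda>T. integral {0..T} (\<lambda>t. arctan (OU (wiener_shift t \<omega>))) / T) \<longlongrightarrow> 0) at_top"
  using cont
proof (cases rule: OU_wiener_shift_cases)
  case 1
  have "integral {0..T} (\<lambda>t. arctan (OU (wiener_shift t \<omega>))) = integral {0..T} (\<lambda>t. 0)" for T
    by (rule integral_cong) (simp add: 1)
  then show ?thesis by simp
next
  case 2
  let ?f = "\<lambda>t. arctan (OU (wiener_shift t \<omega>))" and ?g = "\<lambda>t. arctan (ou_zero \<omega> t)"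
  define c where "c = \<bar>OU \<omega>\<bar>"
  have cf: "continuous_on {0..} ?f" and cg: "continuous_on {0..} ?g"
    by (intro continuous_on_arctan continuous_on_OU_wiener_shift continuous_on_ou_zero cont)+
  have bound: "\<bar>integral {0..T} ?f - integral {0..T} ?g\<bar> \<le> c" if T: "0 \<le> T" for T
  proof -
    have int: "?f integrable_on {0..T}" "?g integrable_on {0..T}"
      by (rule integrable_continuous_real, rule continuous_on_subset[OF cf] continuous_on_subset[OF cg], force)+
    have I: "((\<lambda>t. exp (- t) * c) has_integral (- exp (- T) * c) - (- exp (- 0) * c)) {0..T}"
      using T by (intro fundamental_theorem_of_calculus)
        (auto intro!: derivative_eq_intros simp flip: has_real_derivative_iff_has_vector_derivative)
    have "\<bar>integral {0..T} (\<lambda>t. ?f t - ?g t)\<bar> \<le> integral {0..T} (\<lambda>t. exp (- t) * c)"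
      unfolding real_norm_def[symmetric]
    proof (intro integral_norm_bound_integral integrable_diff int)
      show "(\<lambda>t. exp (- t) * c) integrable_on {0..T}" using I by blast
      fix t assume "t \<in> {0..T}"
      then have "\<bar>OU (wiener_shift t \<omega>) - ou_zero \<omega> t\<bar> = exp (- t) * c"
        using 2[of t] by (simp add: c_def abs_mult)
      then show "norm (?f t - ?g t) \<le> exp (- t) * c"
        using abs_arctan_diff_le[of "OU (wiener_shift t \<omega>)" "ou_zero \<omega> t"] by simp
    qed
    also have "\<dots> = (1 - exp (- T)) * c" using I by (simp add: has_integral_iff algebra_simps)
    also have "\<dots> \<le> c" by (simp add: c_def algebra_simps)
    finally show ?thesis using int by (simp add: Henstock_Kurzweil_Integration.integral_diff)
  qed
  have "((\<lambda>T. (integral {0..T} ?f - integral {0..T} ?g) / T) \<longlongrightarrow> 0) at_top"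
  proof (rule Lim_null_comparison)
    show "((\<lambda>T::real. c / T) \<longlongrightarrow> 0) at_top"
      by (rule tendsto_divide_0[OF tendsto_const filterlim_at_top_imp_at_infinity[OF filterlim_ident]])
    show "eventually (\<lambda>T. norm ((integral {0..T} ?f - integral {0..T} ?g) / T) \<le> c / T) at_top"
      using eventually_gt_at_top[of 0]
      by eventually_elim (use bound in \<open>auto simp: abs_divide intro!: divide_right_mono\<close>)
  qed
  from tendsto_add[OF this lim] show ?thesis by (simp add: diff_divide_distrib)
qed

section \<open>Correlations of a Gaussian autoregression\<close>

lemma ar1_add: "ar1 q x (j + n) = q ^ n * ar1 q x j + (\<Sum>i\<in>{j..<j + n}. q ^ (j + n - Suc i) * x i)"
proof (induction n)
  case 0
  then show ?case by simp
next
  case (Suc n)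
  have "q ^ (j + Suc n - Suc i) = q * q ^ (j + n - Suc i)" if "i \<in> {j..<j + n}" for i
    using that by (simp add: Suc_diff_Suc flip: power_Suc)
  then have "(\<Sum>i\<in>{j..<j + n}. q ^ (j + Suc n - Suc i) * x i) = q * (\<Sum>i\<in>{j..<j + n}. q ^ (j + n - Suc i) * x i)"
    by (simp add: sum_distrib_left mult.assoc)
  then show ?case using Suc by (simp add: algebra_simps)
qed

lemma ar1_eq_sum: "ar1 q x k = (\<Sum>i<k. q ^ (k - Suc i) * x i)"
  using ar1_add[of q x 0 k] by (simp add: atLeast0LessThan)

lemma sum_power_le_inverse:
  fixes q :: real
  assumes "0 \<le> q" "q < 1"
  shows "(\<Sum>i<k. q ^ i) \<le> 1 / (1 - q)"
  using assms by (simp add: sum_gp_strict divide_right_mono)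

lemma (in prob_space) expectation_arctan_centered_normal:
  assumes Y: "distributed M lborel Y (normal_density 0 \<sigma>)"
  shows "expectation (\<lambda>\<omega>. arctan (Y \<omega>)) = 0"
proof -
  let ?I = "\<integral>x. normal_density 0 \<sigma> x * arctan x \<partial>lborel"
  have "?I = (\<integral>x. normal_density 0 \<sigma> (- x) * arctan (- x) \<partial>lborel)"
    using lborel_integral_real_affine[of "-1" "\<lambda>x. normal_density 0 \<sigma> x * arctan x" 0] by simp
  also have "\<dots> = - ?I" by (simp add: normal_density_def arctan_minus)
  finally have "?I = 0" by simp
  then show ?thesis using distributed_integral[OF Y, of arctan] by simp
qed

lemma (in prob_space) weighted_sum_centered_normal:
  assumes "finite I" "I \<noteq> {}" and indep: "indep_vars (\<lambda>_. borel) X I"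
    and X: "\<And>i. i \<in> I \<Longrightarrow> distributed M lborel (X i) (normal_density 0 \<sigma>)"
    and "0 < \<sigma>" and w: "\<And>i. i \<in> I \<Longrightarrow> 0 < w i"
  shows "distributed M lborel (\<lambda>\<omega>. \<Sum>i\<in>I. w i * X i \<omega>) (normal_density 0 (sqrt (\<Sum>i\<in>I. (w i * \<sigma>)\<^sup>2)))"
proof -
  have "distributed M lborel (\<lambda>\<omega>. \<Sum>i\<in>I. w i * X i \<omega>)
     (normal_density (\<Sum>i\<in>I. 0) (sqrt (\<Sum>i\<in>I. (w i * \<sigma>)\<^sup>2)))"
  proof (rule sum_indep_normal[OF assms(1,2)])
    show "indep_vars (\<lambda>_. borel) (\<lambda>i \<omega>. w i * X i \<omega>) I"
      by (rule indep_vars_compose2[OF indep]) auto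
    show "0 < w i * \<sigma>" if "i \<in> I" for i using w[OF that] \<open>0 < \<sigma>\<close> by simp
    show "distributed M lborel (\<lambda>\<omega>. w i * X i \<omega>) (normal_density 0 (w i * \<sigma>))" if "i \<in> I" for i
      using normal_density_affine[OF X[OF that] \<open>0 < \<sigma>\<close>, of "w i" 0] w[OF that] by simp
  qed
  then show ?thesis by simp
qed

lemma (in prob_space) integrable_arctan_product:
  assumes "random_variable borel Y" "random_variable borel Z"
  shows "integrable M (\<lambda>\<omega>. arctan (Y \<omega>) * arctan (Z \<omega>))"
proof (rule integrable_const_bound[where B="pi / 2 * (pi / 2)"])
  show "AE \<omega> in M. norm (arctan (Y \<omega>) * arctan (Z \<omega>)) \<le> pi / 2 * (pi / 2)"
    unfolding real_norm_def abs_mult by (intro AE_I2 mult_mono abs_arctan_le_half_pi) auto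
qed (use assms in measurable)

locale gaussian_ar1 = prob_space +
  fixes X :: "nat \<Rightarrow> 'a \<Rightarrow> real" and q \<sigma> :: real
  assumes indep: "\<And>k. indep_vars (\<lambda>_. borel) X {..<k}"
    and normal: "\<And>i. distributed M lborel (X i) (normal_density 0 \<sigma>)"
    and \<sigma>: "0 < \<sigma>" and q: "0 < q" "q < 1"
begin

definition Z :: "nat \<Rightarrow> 'a \<Rightarrow> real" where
  "Z k \<omega> = ar1 q (\<lambda>i. X i \<omega>) k"

lemma X_measurable [measurable]: "random_variable borel (X i)"
  using normal[of i] by (auto dest: distributed_measurable)

lemma Z_measurable [measurable]: "random_variable borel (Z k)"
  unfolding Z_def ar1_eq_sum by measurable

lemma second_moment_Z:
  "integrable M (\<lambda>\<omega>. (Z k \<omega>)\<^sup>2)" "expectation (\<lambda>\<omega>. (Z k \<omega>)\<^sup>2) \<le> \<sigma>\<^sup>2 / (1 - q)"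
proof -
  have "integrable M (\<lambda>\<omega>. (Z k \<omega>)\<^sup>2) \<and> expectation (\<lambda>\<omega>. (Z k \<omega>)\<^sup>2) \<le> \<sigma>\<^sup>2 / (1 - q)"
  proof (cases "k = 0")
    case True
    then show ?thesis using q by (simp add: Z_def)
  next
    case False
    define \<tau>2 where "\<tau>2 = (\<Sum>i<k. (q ^ (k - Suc i) * \<sigma>)\<^sup>2)"
    have d: "distributed M lborel (Z k) (normal_density 0 (sqrt \<tau>2))"
      unfolding Z_def ar1_eq_sum \<tau>2_def
      by (rule weighted_sum_centered_normal) (use False indep normal \<sigma> q in auto)
    have "0 < \<tau>2" unfolding \<tau>2_def using False q \<sigma> by (intro sum_pos) auto
    then have pos: "0 < sqrt \<tau>2" by simp
    have "integrable lborel (\<lambda>x. normal_density 0 (sqrt \<tau>2) x * x\<^sup>2)"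
      using integrable_normal_moment[OF pos, of 0 2] by simp
    then have int: "integrable M (\<lambda>\<omega>. (Z k \<omega>)\<^sup>2)"
      using distributed_integrable[OF d, of "\<lambda>x. x\<^sup>2"] by simp
    have "expectation (\<lambda>\<omega>. (Z k \<omega>)\<^sup>2) = \<tau>2"
      using normal_distributed_variance[OF pos d] normal_distributed_expectation[OF pos d] \<open>0 < \<tau>2\<close> by simp
    also have "\<tau>2 = \<sigma>\<^sup>2 * (\<Sum>i<k. (q ^ i)\<^sup>2)"
      unfolding \<tau>2_def by (subst sum.nat_diff_reindex[symmetric]) (simp add: power_mult_distrib sum_distrib_left mult.commute)
    also have "\<dots> \<le> \<sigma>\<^sup>2 * (\<Sum>i<k. q ^ i)"
    proof (intro mult_left_mono sum_mono)
      fix i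
      have "q ^ i * q ^ i \<le> q ^ i * 1" using q by (intro mult_left_mono power_le_one) auto
      then show "(q ^ i)\<^sup>2 \<le> q ^ i" by (simp add: power2_eq_square)
    qed simp
    also have "\<dots> \<le> \<sigma>\<^sup>2 * (1 / (1 - q))"
      using q by (intro mult_left_mono sum_power_le_inverse) auto
    finally show ?thesis using int by simp
  qed
  then show "integrable M (\<lambda>\<omega>. (Z k \<omega>)\<^sup>2)" "expectation (\<lambda>\<omega>. (Z k \<omega>)\<^sup>2) \<le> \<sigma>\<^sup>2 / (1 - q)" by auto
qed

lemma abs_moment_Z:
  "integrable M (\<lambda>\<omega>. \<bar>Z k \<omega>\<bar>)" "expectation (\<lambda>\<omega>. \<bar>Z k \<omega>\<bar>) \<le> (1 + \<sigma>\<^sup>2 / (1 - q)) / 2"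
proof -
  have le: "\<bar>x\<bar> \<le> (1 + x\<^sup>2) / 2" for x :: real
    using zero_le_power2[of "\<bar>x\<bar> - 1"] by (simp add: power2_diff)
  have int: "integrable M (\<lambda>\<omega>. (1 + (Z k \<omega>)\<^sup>2) / 2)" using second_moment_Z(1) by simp
  show 1: "integrable M (\<lambda>\<omega>. \<bar>Z k \<omega>\<bar>)"
    by (rule Bochner_Integration.integrable_bound[OF int]) (use le in auto)
  have "expectation (\<lambda>\<omega>. \<bar>Z k \<omega>\<bar>) \<le> expectation (\<lambda>\<omega>. (1 + (Z k \<omega>)\<^sup>2) / 2)"
    by (rule integral_mono[OF 1 int le])
  also have "\<dots> = (1 + expectation (\<lambda>\<omega>. (Z k \<omega>)\<^sup>2)) / 2"
    using second_moment_Z(1) by (simp add: prob_space)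
  also have "\<dots> \<le> (1 + \<sigma>\<^sup>2 / (1 - q)) / 2" using second_moment_Z(2)[of k] by (intro divide_right_mono add_left_mono) auto
  finally show "expectation (\<lambda>\<omega>. \<bar>Z k \<omega>\<bar>) \<le> (1 + \<sigma>\<^sup>2 / (1 - q)) / 2" .
qed

definition C :: real where
  "C = pi / 2 * ((1 + \<sigma>\<^sup>2 / (1 - q)) / 2)"

lemma C_nonneg: "0 \<le> C"
  using q by (simp add: C_def)

text \<open>\<open>Z (j + n)\<close> is \<open>q ^ n * Z j\<close> plus a symmetric variable independent of \<open>Z j\<close>; replacing
  \<open>Z (j + n)\<close> by the latter makes the covariance vanish.\<close>

lemma covariance_arctan_Z:
  "expectation (\<lambda>\<omega>. arctan (Z j \<omega>) * arctan (Z (j + n) \<omega>)) \<le> C * q ^ n"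
proof -
  define Y where "Y = (\<lambda>\<omega>. \<Sum>i\<in>{j..<j + n}. q ^ (j + n - Suc i) * X i \<omega>)"
  have Y_measurable [measurable]: "random_variable borel Y"
    unfolding Y_def by measurable
  have ZY: "Z (j + n) \<omega> = q ^ n * Z j \<omega> + Y \<omega>" for \<omega>
    by (simp add: Z_def Y_def ar1_add)
  have zero: "expectation (\<lambda>\<omega>. arctan (Z j \<omega>) * arctan (Y \<omega>)) = 0"
  proof (cases "n = 0")
    case True
    then show ?thesis by (simp add: Y_def)
  next
    case False
    have "expectation (\<lambda>\<omega>. arctan (Y \<omega>)) = 0"
      unfolding Y_def
      by (rule expectation_arctan_centered_normal, rule weighted_sum_centered_normal)
         (use False normal \<sigma> q in \<open>auto intro: indep_vars_subset[OF indep[of "j + n"]]\<close>)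
    moreover have "indep_var borel (\<lambda>\<omega>. arctan (Z j \<omega>)) borel (\<lambda>\<omega>. arctan (Y \<omega>))"
    proof -
      have "indep_var borel ((\<lambda>f. arctan (\<Sum>i<j. q ^ (j - Suc i) * f i)) \<circ> (\<lambda>\<omega>. restrict (\<lambda>i. X i \<omega>) {..<j}))
          borel ((\<lambda>f. arctan (\<Sum>i\<in>{j..<j + n}. q ^ (j + n - Suc i) * f i)) \<circ> (\<lambda>\<omega>. restrict (\<lambda>i. X i \<omega>) {j..<j + n}))"
        by (intro indep_var_compose[OF indep_var_restrict[OF indep[of "j + n"]]]) auto
      then show ?thesis by (simp add: comp_def Z_def ar1_eq_sum Y_def)
    qed
    moreover have "integrable M (\<lambda>\<omega>. arctan (V \<omega>))" if [measurable]: "random_variable borel V" for V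
      by (rule integrable_const_bound[where B="pi / 2"]) (auto simp del: le_divide_eq_numeral1 simp: abs_arctan_le_half_pi)
    ultimately show ?thesis
      by (subst indep_var_lebesgue_integral) auto
  qed
  have "expectation (\<lambda>\<omega>. arctan (Z j \<omega>) * arctan (Z (j + n) \<omega>))
      = expectation (\<lambda>\<omega>. arctan (Z j \<omega>) * arctan (Z (j + n) \<omega>)) - expectation (\<lambda>\<omega>. arctan (Z j \<omega>) * arctan (Y \<omega>))"
    using zero by simp
  also have "\<dots> = expectation (\<lambda>\<omega>. arctan (Z j \<omega>) * arctan (Z (j + n) \<omega>) - arctan (Z j \<omega>) * arctan (Y \<omega>))"
    by (intro Bochner_Integration.integral_diff[symmetric] integrable_arctan_product) measurable
  also have "\<dots> \<le> expectation (\<lambda>\<omega>. pi / 2 * q ^ n * \<bar>Z j \<omega>\<bar>)"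
  proof (rule integral_mono)
    show "integrable M (\<lambda>\<omega>. arctan (Z j \<omega>) * arctan (Z (j + n) \<omega>) - arctan (Z j \<omega>) * arctan (Y \<omega>))"
      by (intro Bochner_Integration.integrable_diff integrable_arctan_product) measurable
    show "integrable M (\<lambda>\<omega>. pi / 2 * q ^ n * \<bar>Z j \<omega>\<bar>)"
      by (intro integrable_mult_right abs_moment_Z(1))
    fix \<omega>
    have "\<bar>arctan (Z (j + n) \<omega>) - arctan (Y \<omega>)\<bar> \<le> q ^ n * \<bar>Z j \<omega>\<bar>"
      using abs_arctan_diff_le[of "Z (j + n) \<omega>" "Y \<omega>"] q by (simp add: ZY abs_mult)
    then have "\<bar>arctan (Z j \<omega>) * (arctan (Z (j + n) \<omega>) - arctan (Y \<omega>))\<bar> \<le> pi / 2 * (q ^ n * \<bar>Z j \<omega>\<bar>)"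
      unfolding abs_mult by (intro mult_mono abs_arctan_le_half_pi) auto
    then show "arctan (Z j \<omega>) * arctan (Z (j + n) \<omega>) - arctan (Z j \<omega>) * arctan (Y \<omega>) \<le> pi / 2 * q ^ n * \<bar>Z j \<omega>\<bar>"
      unfolding right_diff_distrib mult.assoc by (rule order_trans[OF abs_ge_self])
  qed
  also have "\<dots> = pi / 2 * q ^ n * expectation (\<lambda>\<omega>. \<bar>Z j \<omega>\<bar>)" by simp
  also have "\<dots> \<le> pi / 2 * q ^ n * ((1 + \<sigma>\<^sup>2 / (1 - q)) / 2)"
    using q by (intro mult_left_mono abs_moment_Z(2)) auto
  also have "\<dots> = C * q ^ n" by (simp add: C_def)
  finally show ?thesis .
qed

lemma second_moment_sum_arctan_Z:
  "integrable M (\<lambda>\<omega>. (\<Sum>k<n. arctan (Z k \<omega>))\<^sup>2)"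
  "expectation (\<lambda>\<omega>. (\<Sum>k<n. arctan (Z k \<omega>))\<^sup>2) \<le> real n * (2 * C / (1 - q))"
proof -
  have int: "integrable M (\<lambda>\<omega>. arctan (Z j \<omega>) * arctan (Z k \<omega>))" for j k
    by (rule integrable_arctan_product) measurable
  show sq: "integrable M (\<lambda>\<omega>. (\<Sum>k<n. arctan (Z k \<omega>))\<^sup>2)" for n
    unfolding power2_eq_square sum_product by (intro Bochner_Integration.integrable_sum int)
  show "expectation (\<lambda>\<omega>. (\<Sum>k<n. arctan (Z k \<omega>))\<^sup>2) \<le> real n * (2 * C / (1 - q))"
  proof (induction n)
    case 0
    then show ?case by simp
  next
    case (Suc n)
    have "expectation (\<lambda>\<omega>. (\<Sum>k<Suc n. arctan (Z k \<omega>))\<^sup>2) \<le>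
      expectation (\<lambda>\<omega>. (\<Sum>k<n. arctan (Z k \<omega>))\<^sup>2 + 2 * (\<Sum>j<Suc n. arctan (Z j \<omega>) * arctan (Z n \<omega>)))"
    proof (rule integral_mono[OF sq])
      show "integrable M (\<lambda>\<omega>. (\<Sum>k<n. arctan (Z k \<omega>))\<^sup>2 + 2 * (\<Sum>j<Suc n. arctan (Z j \<omega>) * arctan (Z n \<omega>)))"
        by (intro Bochner_Integration.integrable_add sq integrable_mult_right Bochner_Integration.integrable_sum int)
      show "(\<Sum>k<Suc n. arctan (Z k \<omega>))\<^sup>2 \<le> (\<Sum>k<n. arctan (Z k \<omega>))\<^sup>2 + 2 * (\<Sum>j<Suc n. arctan (Z j \<omega>) * arctan (Z n \<omega>))" for \<omega>
        by (simp add: power2_eq_square algebra_simps sum_distrib_left sum_distrib_right)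
    qed
    also have "\<dots> = expectation (\<lambda>\<omega>. (\<Sum>k<n. arctan (Z k \<omega>))\<^sup>2)
        + 2 * (\<Sum>j<Suc n. expectation (\<lambda>\<omega>. arctan (Z j \<omega>) * arctan (Z n \<omega>)))"
      using int sq by (subst Bochner_Integration.integral_add)
        (auto intro!: Bochner_Integration.integrable_add integrable_mult_right Bochner_Integration.integrable_sum
           simp: Bochner_Integration.integral_sum simp del: sum.lessThan_Suc)
    also have "(\<Sum>j<Suc n. expectation (\<lambda>\<omega>. arctan (Z j \<omega>) * arctan (Z n \<omega>))) \<le> (\<Sum>j<Suc n. C * q ^ (n - j))"
    proof (rule sum_mono)
      fix j assume "j \<in> {..<Suc n}"
      then show "expectation (\<lambda>\<omega>. arctan (Z j \<omega>) * arctan (Z n \<omega>)) \<le> C * q ^ (n - j)"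
        using covariance_arctan_Z[of j "n - j"] by simp
    qed
    also have "\<dots> = C * (\<Sum>i<Suc n. q ^ i)"
      unfolding sum_distrib_left by (subst sum.nat_diff_reindex[symmetric]) simp
    also have "\<dots> \<le> C * (1 / (1 - q))"
      using q C_nonneg by (intro mult_left_mono sum_power_le_inverse) auto
    finally have "expectation (\<lambda>\<omega>. (\<Sum>k<Suc n. arctan (Z k \<omega>))\<^sup>2)
        \<le> expectation (\<lambda>\<omega>. (\<Sum>k<n. arctan (Z k \<omega>))\<^sup>2) + 2 * C / (1 - q)" by simp
    also have "\<dots> \<le> real (Suc n) * (2 * C / (1 - q))"
      using Suc unfolding of_nat_Suc distrib_right by simp
    finally show ?case .
  qed
qed

end

lemma (in prob_space) AE_tendsto_0_if_summable_second_moments: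
  fixes Y :: "nat \<Rightarrow> 'a \<Rightarrow> real"
  assumes int: "\<And>k. integrable M (\<lambda>\<omega>. (Y k \<omega>)\<^sup>2)"
    and sum: "summable (\<lambda>k. expectation (\<lambda>\<omega>. (Y k \<omega>)\<^sup>2))"
  shows "AE \<omega> in M. (\<lambda>k. Y k \<omega>) \<longlonglongrightarrow> 0"
proof -
  have meas[measurable]: "(\<lambda>\<omega>. (Y k \<omega>)\<^sup>2) \<in> borel_measurable M" for k
    using int by auto
  have "(\<integral>\<^sup>+\<omega>. (\<Sum>k. ennreal ((Y k \<omega>)\<^sup>2)) \<partial>M) = (\<Sum>k. \<integral>\<^sup>+\<omega>. ennreal ((Y k \<omega>)\<^sup>2) \<partial>M)"
    by (intro nn_integral_suminf) measurable
  also have "\<dots> = (\<Sum>k. ennreal (expectation (\<lambda>\<omega>. (Y k \<omega>)\<^sup>2)))"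
    using int by (intro suminf_cong nn_integral_eq_integral) auto
  also have "\<dots> \<noteq> \<infinity>"
    using sum by (simp add: suminf_ennreal2)
  finally have "AE \<omega> in M. (\<Sum>k. ennreal ((Y k \<omega>)\<^sup>2)) \<noteq> \<infinity>"
    by (intro nn_integral_PInf_AE) auto
  then show ?thesis
  proof eventually_elim
    case (elim \<omega>)
    then have "summable (\<lambda>k. (Y k \<omega>)\<^sup>2)"
      by (intro summable_suminf_not_top) auto
    then have "(\<lambda>k. (Y k \<omega>)\<^sup>2) \<longlonglongrightarrow> 0" by (rule summable_LIMSEQ_zero)
    then have "(\<lambda>k. sqrt ((Y k \<omega>)\<^sup>2)) \<longlonglongrightarrow> sqrt 0" by (rule tendsto_real_sqrt)
    then show ?case by (simp add: tendsto_rabs_zero_iff)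
  qed
qed

lemma mean_tendsto_0_if_along_squares:
  fixes A :: "real \<Rightarrow> real"
  assumes lip: "\<And>s t. 0 \<le> s \<Longrightarrow> s \<le> t \<Longrightarrow> \<bar>A t - A s\<bar> \<le> c * (t - s)"
    and lim: "(\<lambda>k. A (real (k\<^sup>2)) / real (k\<^sup>2)) \<longlonglongrightarrow> 0"
  shows "((\<lambda>T. A T / T) \<longlongrightarrow> 0) at_top"
proof -
  have "0 \<le> c" using lip[of 0 1] by simp
  define k where "k T = nat \<lfloor>sqrt T\<rfloor>" for T
  have k_lim: "filterlim k at_top at_top"
    unfolding k_def
    by (intro filterlim_compose[OF filterlim_nat_sequentially] filterlim_compose[OF filterlim_floor_sequentially] sqrt_at_top)
  have bound: "norm (A T / T) \<le> \<bar>A (real ((k T)\<^sup>2)) / real ((k T)\<^sup>2)\<bar> + 3 * c / real (k T)" if "1 \<le> T" for T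
  proof -
    have s1: "1 \<le> sqrt T" using that by simp
    have kf: "real (k T) = of_int \<lfloor>sqrt T\<rfloor>" using s1 by (simp add: k_def)
    have k1: "1 \<le> real (k T)" using s1 by (simp add: kf)
    have kl: "real (k T) \<le> sqrt T" "sqrt T \<le> real (k T) + 1" unfolding kf by linarith+
    have "(real (k T))\<^sup>2 \<le> (sqrt T)\<^sup>2" "(sqrt T)\<^sup>2 \<le> (real (k T) + 1)\<^sup>2"
      using kl k1 s1 by (intro power_mono; linarith)+
    then have T: "(real (k T))\<^sup>2 \<le> T" "T - (real (k T))\<^sup>2 \<le> 2 * real (k T) + 1" using that by (auto simp: power2_sum)
    let ?K = "(real (k T))\<^sup>2"
    have K: "0 < ?K" using k1 by simp
    have "\<bar>A T\<bar> \<le> \<bar>A ?K\<bar> + c * (T - ?K)" using lip[of ?K T] T by auto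
    also have "\<dots> \<le> \<bar>A ?K\<bar> + c * (3 * real (k T))"
      using T(2) k1 \<open>0 \<le> c\<close> by (intro add_left_mono mult_left_mono) auto
    finally have "\<bar>A T\<bar> / T \<le> (\<bar>A ?K\<bar> + c * (3 * real (k T))) / T"
      using that by (intro divide_right_mono) auto
    also have "\<dots> \<le> (\<bar>A ?K\<bar> + c * (3 * real (k T))) / ?K"
      using T(1) K \<open>0 \<le> c\<close> that by (intro divide_left_mono mult_pos_pos) auto
    also have "\<dots> = \<bar>A ?K / ?K\<bar> + 3 * c / real (k T)"
      using k1 by (simp add: field_simps power2_eq_square abs_divide)
    finally show ?thesis using that by (simp add: abs_divide)
  qed
  have inv_lim: "((\<lambda>T. 3 * c / real (k T)) \<longlongrightarrow> 0) at_top"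
    using filterlim_compose[OF lim_const_over_n[of "3 * c"] k_lim] by simp
  have "((\<lambda>T. \<bar>A (real ((k T)\<^sup>2)) / real ((k T)\<^sup>2)\<bar> + 3 * c / real (k T)) \<longlongrightarrow> 0 + 0) at_top"
    using filterlim_compose[OF lim k_lim] by (intro tendsto_add tendsto_rabs_zero inv_lim) simp
  then have lim0: "((\<lambda>T. \<bar>A (real ((k T)\<^sup>2)) / real ((k T)\<^sup>2)\<bar> + 3 * c / real (k T)) \<longlongrightarrow> 0) at_top"
    by simp
  have "eventually (\<lambda>T. norm (A T / T) \<le> \<bar>A (real ((k T)\<^sup>2)) / real ((k T)\<^sup>2)\<bar> + 3 * c / real (k T)) at_top"
    using eventually_ge_at_top[of 1] by eventually_elim (rule bound)
  then show ?thesis by (rule Lim_null_comparison[OF _ lim0])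
qed

section \<open>The time mean under Wiener measure\<close>

lemma wiener_measure_gaussian_ar1:
  assumes P: "wiener_measure P" and h: "0 < h"
  shows "gaussian_ar1 P (\<lambda>i \<omega>. \<omega> (real (Suc i) * h) - \<omega> (real i * h)) (exp (- h)) (sqrt h)"
proof -
  interpret prob_space P using P by (simp add: wiener_measure_def)
  show ?thesis
  proof
    fix k :: nat
    define ts where "ts = map (\<lambda>i. real i * h) [0..<Suc k]"
    have len: "length ts = Suc k" by (simp add: ts_def)
    have nth: "ts ! i = real i * h" if "i \<le> k" for i
      using that by (simp add: ts_def del: upt_Suc)
    have "sorted ts" "distinct ts"
      using h by (auto simp: ts_def sorted_iff_nth_mono distinct_map inj_on_def simp del: upt_Suc)
    then have "indep_vars (\<lambda>_. borel) (\<lambda>i \<omega>. \<omega> (ts ! Suc i) - \<omega> (ts ! i)) {..<length ts - 1}"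
      using P unfolding wiener_measure_def by blast
    then show "indep_vars (\<lambda>_. borel) (\<lambda>i \<omega>. \<omega> (real (Suc i) * h) - \<omega> (real i * h)) {..<k}"
      by (rule indep_vars_cong[THEN iffD1, rotated -1]) (auto simp: len nth)
  next
    fix i :: nat
    have "real i * h < real (Suc i) * h" using h by simp
    then have "distributed P lborel (\<lambda>\<omega>. \<omega> (real (Suc i) * h) - \<omega> (real i * h))
       (\<lambda>x. ennreal (normal_density 0 (sqrt (real (Suc i) * h - real i * h)) x))"
      using P unfolding wiener_measure_def by blast
    then show "distributed P lborel (\<lambda>\<omega>. \<omega> (real (Suc i) * h) - \<omega> (real i * h))
       (\<lambda>x. ennreal (normal_density 0 (sqrt h) x))"
      by (simp add: algebra_simps)
  qed (use h in auto)
qed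

lemma step_over_one_minus_exp_le:
  fixes h :: real
  assumes "0 < h" "h \<le> 1"
  shows "h / (1 - exp (- h)) \<le> 2"
proof -
  have "(1 + h) * exp (- h) \<le> exp h * exp (- h)"
    by (intro mult_right_mono exp_ge_add_one_self) auto
  then have "(1 + h) * exp (- h) \<le> 1" by (simp flip: exp_add)
  then have "exp (- h) \<le> 1 / (1 + h)" using assms by (simp add: field_simps)
  also have "\<dots> \<le> 1 - h / 2"
    using assms mult_left_mono[of h 1 h] by (simp add: field_simps)
  finally show ?thesis using assms by (simp add: field_simps)
qed

lemma second_moment_integral_arctan_ou_zero:
  fixes n :: nat
  assumes P: "wiener_measure P"
  shows "integrable P (\<lambda>\<omega>. (integral {0..real n} (\<lambda>t. arctan (ou_zero \<omega> t)))\<^sup>2)"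
    and "(\<integral>\<omega>. (integral {0..real n} (\<lambda>t. arctan (ou_zero \<omega> t)))\<^sup>2 \<partial>P) \<le> 3 * pi * real n"
proof -
  interpret prob_space P using P by (simp add: wiener_measure_def)
  define S where "S N \<omega> = inverse (real N) * (\<Sum>k<N * n. arctan (ar1 (exp (- inverse (real N)))
           (\<lambda>i. \<omega> (real (Suc i) * inverse (real N)) - \<omega> (real i * inverse (real N))) k))" for N \<omega>
  define A where "A \<omega> = integral {0..real n} (\<lambda>t. arctan (ou_zero \<omega> t))" for \<omega>
  have S_bound: "\<bar>S N \<omega>\<bar> \<le> real n * (pi / 2)" for N \<omega>
  proof (cases "N = 0")
    case False
    have "\<bar>S N \<omega>\<bar> \<le> inverse (real N) * (\<Sum>k<N * n. pi / 2)"
      unfolding S_def abs_mult abs_inverse abs_of_nat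
      by (intro mult_left_mono order_trans[OF sum_abs] sum_mono abs_arctan_le_half_pi) auto
    also have "\<dots> = real n * (pi / 2)" using False by (simp add: field_simps)
    finally show ?thesis .
  qed (simp add: S_def)
  have S: "integrable P (\<lambda>\<omega>. (S N \<omega>)\<^sup>2) \<and> S N \<in> borel_measurable P \<and> expectation (\<lambda>\<omega>. (S N \<omega>)\<^sup>2) \<le> 3 * pi * real n" for N
  proof (cases "N = 0")
    case True
    then show ?thesis by (simp add: S_def[abs_def])
  next
    case False
    define h where "h = inverse (real N)"
    have h: "0 < h" "h \<le> 1" "h * real N = 1" using False by (auto simp: h_def inverse_le_1_iff)
    interpret G: gaussian_ar1 P "\<lambda>i \<omega>. \<omega> (real (Suc i) * h) - \<omega> (real i * h)" "exp (- h)" "sqrt h"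
      by (rule wiener_measure_gaussian_ar1[OF P h(1)])
    have S_eq: "S N = (\<lambda>\<omega>. h * (\<Sum>k<N * n. arctan (G.Z k \<omega>)))"
      by (rule ext) (simp only: S_def G.Z_def flip: h_def)
    have step: "h / (1 - exp (- h)) \<le> 2" using h by (intro step_over_one_minus_exp_le) auto
    have "(1 + (sqrt h)\<^sup>2 / (1 - exp (- h))) / 2 \<le> 3 / 2"
      unfolding real_sqrt_pow2[OF less_imp_le[OF h(1)]]
      by (rule divide_right_mono) (use add_left_mono[OF step, of 1] in auto)
    then have C: "G.C \<le> pi / 2 * (3 / 2)"
      unfolding G.C_def by (rule mult_left_mono) simp
    have "h\<^sup>2 * expectation (\<lambda>\<omega>. (\<Sum>k<N * n. arctan (G.Z k \<omega>))\<^sup>2) \<le> h\<^sup>2 * (real (N * n) * (2 * G.C / (1 - exp (- h))))"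
      by (intro mult_left_mono G.second_moment_sum_arctan_Z) auto
    also have "\<dots> = (h * real N) * real n * 2 * G.C * (h / (1 - exp (- h)))"
      by (simp add: power2_eq_square)
    also have "\<dots> \<le> (h * real N) * real n * 2 * (pi / 2 * (3 / 2)) * 2"
      using C step h G.C_nonneg by (intro mult_mono) auto
    also have "\<dots> = 3 * pi * real n" using h by simp
    finally have "expectation (\<lambda>\<omega>. (S N \<omega>)\<^sup>2) \<le> 3 * pi * real n"
      unfolding S_eq power_mult_distrib by simp
    moreover have "integrable P (\<lambda>\<omega>. (S N \<omega>)\<^sup>2)"
      unfolding S_eq power_mult_distrib by (intro integrable_mult_right G.second_moment_sum_arctan_Z)
    moreover have "S N \<in> borel_measurable P"
      unfolding S_eq by measurable
    ultimately show ?thesis by blast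
  qed
  have lim: "(\<lambda>N. S N \<omega>) \<longlonglongrightarrow> A \<omega>" if "\<omega> \<in> space P" for \<omega>
    unfolding S_def A_def using that P
    by (intro riemann_sum_tendsto_integral_arctan_ou_zero) (auto simp: wiener_measure_def Omega_def)
  have meas: "(\<lambda>\<omega>. (A \<omega>)\<^sup>2) \<in> borel_measurable P"
    using S by (intro borel_measurable_power borel_measurable_LIMSEQ_real[OF lim]) auto
  have AE_lim: "AE \<omega> in P. (\<lambda>N. (S N \<omega>)\<^sup>2) \<longlonglongrightarrow> (A \<omega>)\<^sup>2"
    using lim by (intro AE_I2 tendsto_power)
  have AE_bound: "AE \<omega> in P. norm ((S N \<omega>)\<^sup>2) \<le> (real n * (pi / 2))\<^sup>2" for N
    using power_mono[OF S_bound abs_ge_zero, of N _ 2] by simp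
  show "integrable P (\<lambda>\<omega>. (integral {0..real n} (\<lambda>t. arctan (ou_zero \<omega> t)))\<^sup>2)"
    unfolding A_def[symmetric]
    by (rule integrable_dominated_convergence[OF meas _ _ AE_lim AE_bound]) (use S in auto)
  have "(\<lambda>N. expectation (\<lambda>\<omega>. (S N \<omega>)\<^sup>2)) \<longlonglongrightarrow> expectation (\<lambda>\<omega>. (A \<omega>)\<^sup>2)"
    by (rule integral_dominated_convergence[OF meas _ _ AE_lim AE_bound]) (use S in auto)
  then show "(\<integral>\<omega>. (integral {0..real n} (\<lambda>t. arctan (ou_zero \<omega> t)))\<^sup>2 \<partial>P) \<le> 3 * pi * real n"
    unfolding A_def[symmetric] by (rule LIMSEQ_le_const2) (use S in auto)
qed

lemma AE_mean_arctan_ou_zero: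
  assumes P: "wiener_measure P"
  shows "AE \<omega> in P. ((\<lambda>T. integral {0..T} (\<lambda>t. arctan (ou_zero \<omega> t)) / T) \<longlongrightarrow> 0) at_top"
proof -
  interpret prob_space P using P by (simp add: wiener_measure_def)
  define A where "A \<omega> T = integral {0..T} (\<lambda>t. arctan (ou_zero \<omega> t))" for \<omega> T
  have moment: "integrable P (\<lambda>\<omega>. (A \<omega> (real n))\<^sup>2)" "expectation (\<lambda>\<omega>. (A \<omega> (real n))\<^sup>2) \<le> 3 * pi * real n" for n
    using second_moment_integral_arctan_ou_zero[OF P, of n] by (auto simp: A_def)
  have "AE \<omega> in P. (\<lambda>k. A \<omega> (real (k\<^sup>2)) / real (k\<^sup>2)) \<longlonglongrightarrow> 0"
  proof (rule AE_tendsto_0_if_summable_second_moments)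
    show "integrable P (\<lambda>\<omega>. (A \<omega> (real (k\<^sup>2)) / real (k\<^sup>2))\<^sup>2)" for k
      unfolding power_divide by (intro integrable_divide moment)
    have le: "expectation (\<lambda>\<omega>. (A \<omega> (real (k\<^sup>2)) / real (k\<^sup>2))\<^sup>2) \<le> 3 * pi * inverse ((real k)\<^sup>2)" for k
    proof (cases "k = 0")
      case False
      have "expectation (\<lambda>\<omega>. (A \<omega> (real (k\<^sup>2)) / real (k\<^sup>2))\<^sup>2) = expectation (\<lambda>\<omega>. (A \<omega> (real (k\<^sup>2)))\<^sup>2) / (real (k\<^sup>2))\<^sup>2"
        unfolding power_divide by simp
      also have "\<dots> \<le> 3 * pi * real (k\<^sup>2) / (real (k\<^sup>2))\<^sup>2"
        by (intro divide_right_mono moment) auto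
      also have "\<dots> = 3 * pi * inverse ((real k)\<^sup>2)"
        using False by (simp add: field_simps power2_eq_square)
      finally show ?thesis .
    qed simp
    show "summable (\<lambda>k. expectation (\<lambda>\<omega>. (A \<omega> (real (k\<^sup>2)) / real (k\<^sup>2))\<^sup>2))"
    proof (rule summable_comparison_test')
      show "summable (\<lambda>k. 3 * pi * inverse ((real k)\<^sup>2))"
        by (intro summable_mult inverse_power_summable) auto
      show "norm (expectation (\<lambda>\<omega>. (A \<omega> (real (k\<^sup>2)) / real (k\<^sup>2))\<^sup>2)) \<le> 3 * pi * inverse ((real k)\<^sup>2)" for k
        using le[of k] by (subst real_norm_def, subst abs_of_nonneg) (auto intro: integral_nonneg_AE)
    qed
  qed
  then show ?thesis
  proof (rule AE_mp, intro AE_I2 impI)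
    fix \<omega> assume "\<omega> \<in> space P" and lim: "(\<lambda>k. A \<omega> (real (k\<^sup>2)) / real (k\<^sup>2)) \<longlonglongrightarrow> 0"
    then have "continuous_on UNIV \<omega>" using P by (auto simp: wiener_measure_def Omega_def)
    then have cont: "continuous_on {0..} (\<lambda>t. arctan (ou_zero \<omega> t))"
      by (intro continuous_on_arctan continuous_on_ou_zero)
    have "((\<lambda>T. A \<omega> T / T) \<longlongrightarrow> 0) at_top"
    proof (rule mean_tendsto_0_if_along_squares[OF _ lim])
      fix s t :: real assume st: "0 \<le> s" "s \<le> t"
      have int: "(\<lambda>t. arctan (ou_zero \<omega> t)) integrable_on {x..y}" if "0 \<le> x" for x y
        by (rule integrable_continuous_real, rule continuous_on_subset[OF cont]) (use that in auto)
      have "A \<omega> s + integral {s..t} (\<lambda>t. arctan (ou_zero \<omega> t)) = A \<omega> t"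
        unfolding A_def using st int by (intro Henstock_Kurzweil_Integration.integral_combine) auto
      then have "A \<omega> t - A \<omega> s = integral {s..t} (\<lambda>t. arctan (ou_zero \<omega> t))" by simp
      moreover have "norm (integral {s..t} (\<lambda>t. arctan (ou_zero \<omega> t))) \<le> integral {s..t} (\<lambda>t. pi / 2)"
        using st int abs_arctan_le_half_pi unfolding real_norm_def[symmetric] by (intro integral_norm_bound_integral) blast+
      ultimately show "\<bar>A \<omega> t - A \<omega> s\<bar> \<le> pi / 2 * (t - s)" using st by (simp add: mult.commute)
    qed
    then show "((\<lambda>T. integral {0..T} (\<lambda>t. arctan (ou_zero \<omega> t)) / T) \<longlongrightarrow> 0) at_top"
      by (simp add: A_def)
  qed
qed

theorem theorem4p1:
  fixes P :: "(real \<Rightarrow> real) measure"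
    and D a s_in \<alpha> c g r d \<alpha>1 \<alpha>2 r1 r2 :: real
    and \<mu> :: "real \<Rightarrow> real"
  assumes P: "wiener_measure P"
    and D: "D > 0" and s_in: "s_in > 0" and \<alpha>: "\<alpha> > 0" and c: "c > 0"
    and g: "0 < g" "g \<le> c" and r: "0 < r" "r < 1" and d: "d > 0"
    and \<alpha>12: "\<alpha>1 \<ge> 0" "\<alpha>2 \<ge> 0" and r12: "r1 \<ge> 0" "r2 \<ge> 0"
    and \<mu>_cont: "continuous_on {0..} \<mu>" and \<mu>0: "\<mu> 0 = 0"
    and \<mu>_pos: "\<And>x. x > 0 \<Longrightarrow> \<mu> x > 0"
    and \<mu>_le1: "\<And>x. x \<ge> 0 \<Longrightarrow> \<mu> x \<le> 1"
    and a: "0 < a" "a < D"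
    and cond: "D * \<alpha> * (\<alpha>2 / (\<alpha>1 + \<alpha>2 + \<alpha> * (D + a))) + d > g"
  shows "AE \<omega> in P. \<forall>s m1 m2.
           chemostat_solution D a s_in \<alpha> c g r d \<alpha>1 \<alpha>2 r1 r2 \<mu> \<omega> s m1 m2 \<longrightarrow>
           ((\<lambda>t. m1 t + m2 t) \<longlongrightarrow> 0) at_top"
  using AE_mean_arctan_ou_zero[OF P]
proof (rule AE_mp, intro AE_I2 impI allI)
  fix \<omega> and s m1 m2 :: "real \<Rightarrow> real"
  assume "\<omega> \<in> space P"
    and mean: "((\<lambda>T. integral {0..T} (\<lambda>t. arctan (ou_zero \<omega> t)) / T) \<longlongrightarrow> 0) at_top"
    and sol: "chemostat_solution D a s_in \<alpha> c g r d \<alpha>1 \<alpha>2 r1 r2 \<mu> \<omega> s m1 m2"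
  then have \<omega>: "continuous_on UNIV \<omega>" "\<omega> 0 = 0"
    using P by (auto simp: wiener_measure_def Omega_def)
  let ?at = "\<lambda>t. arctan (OU (wiener_shift t \<omega>))"
  define F where "F t = D * t + 2 * a / pi * integral {0..t} ?at" for t
  define R where "R t = - d + g * \<mu> (s t) - r1 * m1 t - r2 * m2 t" for t
  have Drand: "Drand D a \<omega> t = D + 2 * a / pi * ?at t" for t
    by (simp add: Drand_def psi_def)
  have psi_bound: "\<bar>2 * a / pi * ?at t\<bar> \<le> a" for t
  proof -
    have "\<bar>2 * a / pi * ?at t\<bar> \<le> 2 * a / pi * (pi / 2)"
      unfolding abs_mult using a abs_arctan_le_half_pi by (intro mult_mono) auto
    then show ?thesis by simp
  qed
  have nonneg: "0 \<le> s t" "0 \<le> m1 t" "0 \<le> m2 t" if "0 \<le> t" for t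
    using sol that by (auto simp: chemostat_solution_def)
  show "((\<lambda>t. m1 t + m2 t) \<longlongrightarrow> 0) at_top"
  proof (rule total_biomass_tendsto_0)
    fix t :: real assume t: "0 \<le> t"
    show "0 \<le> Drand D a \<omega> t" "Drand D a \<omega> t \<le> D + a"
      using psi_bound[of t] a unfolding Drand by linarith+
    have "g * \<mu> (s t) \<le> g * 1" using g \<mu>_le1 nonneg[OF t] by (intro mult_left_mono) auto
    moreover have "0 \<le> r1 * m1 t" "0 \<le> r2 * m2 t" using r12 nonneg[OF t] by auto
    ultimately show "R t \<le> g - d" by (simp add: R_def)
    show "(m1 has_real_derivative m1 t * (R t - \<alpha> * Drand D a \<omega> t - \<alpha>1) + \<alpha>2 * m2 t) (at t within {0..})"
      "(m2 has_real_derivative m2 t * (R t - \<alpha>2) + \<alpha>1 * m1 t) (at t within {0..})"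
      using sol t by (auto simp: chemostat_solution_def R_def algebra_simps)
    have "((\<lambda>t. integral {0..t} ?at) has_real_derivative ?at t) (at t within {0..})"
      by (intro integral_has_real_derivative_atLeast continuous_on_arctan continuous_on_OU_wiener_shift \<omega> t)
    then show "(F has_real_derivative Drand D a \<omega> t) (at t within {0..})"
      unfolding F_def Drand by (auto intro!: derivative_eq_intros)
  next
    have "((\<lambda>t. D + 2 * a / pi * (integral {0..t} ?at / t)) \<longlongrightarrow> D + 2 * a / pi * 0) at_top"
      by (intro tendsto_intros mean_arctan_OU_tendsto_0[OF \<omega> mean])
    moreover have "eventually (\<lambda>t. D + 2 * a / pi * (integral {0..t} ?at / t) = F t / t) at_top"
      using eventually_gt_at_top[of 0] by eventually_elim (simp add: F_def field_simps)
    ultimately show "((\<lambda>t. F t / t) \<longlongrightarrow> D) at_top"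
      by (simp add: tendsto_cong)
    show "g - d < \<alpha> * D * (\<alpha>2 / (\<alpha>1 + \<alpha>2 + \<alpha> * (D + a)))"
      using cond by (simp add: mult.commute)
  qed (use \<alpha> \<alpha>12 D a nonneg in auto)
qed

end
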